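(* Let $\eta\in\{2,3,\dots\}\sqcup\{\infty\}$ and $\kappa\in\{0,1,2,\dots\}$, and let $\boldsymbol\tau=\{\tau_i\}_{i=1}^\eta$ be a sequence of positive Borel measures on $[0,1]$ such that $\sup_{i\in J_\eta}\tau_i([0,1])<\infty$. Let $\mathscr U_{\eta,\kappa}^{\boldsymbol\tau}$ be the set of all sequences $\{t_i\}_{i=1}^\eta\subseteq(0,\infty)$ satisfying $$\sum_{i=1}^\eta t_i^2<\infty,$$ $$\sum_{i=1}^\eta t_i^2\ge1+\sum_{i=1}^\eta t_i^2\int_0^1\frac1s\,d\tau_i(s)\ \text{ if }\kappa=0,\qquad\sum_{i=1}^\eta t_i^2=1+\sum_{i=1}^\eta t_i^2\int_0^1\frac1s\,d\tau_i(s)\ \text{ if }\kappa>0,$$ $$\sum_{i=1}^\eta t_i^2>\sum_{i=1}^\eta t_i^2\int_0^1\Big(\frac1s+\dots+\frac1{s^{\kappa+1}}\Big)d\tau_i(s).$$ Then the following two conditions are equivalent: (i) $\mathscr U_{\eta,\kappa}^{\boldsymbol\tau}\ne\varnothing$; (ii) $\int_0^1\frac1{s^{\kappa+1}}\,d\tau_i(s)<\infty$ for all $i\in J_\eta$, and $\int_0^1\sum_{l=1}^{\kappa+1}\frac1{s^l}\,d\tau_{i_0}(s)<1$ for some $i_0\in J_\eta$.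
   Context: $J_\eta=\{k\in\{1,2,\dots\}:k\le\eta\}$ (so $J_\infty=\{1,2,\dots\}$). $\int_0^1$ means $\int_{[0,1]}$, and $\frac10=\infty$ (so finiteness of $\int_0^1\frac1{s^k}\,d\tau(s)$ with $k\geq 1$ forces $\tau(\{0\})=0$). *)

theory Defs
  imports "HOL-Analysis.Analysis"
begin

definition J :: "enat \<Rightarrow> nat set" where
  "J \<eta> = {k. 1 \<le> k \<and> enat k \<le> \<eta>}"

text \<open>
  All integrals and series are taken in \<open>ennreal\<close>, i.e. with values in the extended half-line;
  there \<open>1 / 0 = \<infinity>\<close>, and every family of elements has a (possibly infinite) sum.
\<close>

definition inv_power_int :: "real measure \<Rightarrow> nat \<Rightarrow> ennreal" where
  "inv_power_int \<mu> k = (\<integral>\<^sup>+ s \<in> {0..1}. (1 / (ennreal s) ^ k) \<partial>\<mu>)"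

definition inv_power_sum_int :: "real measure \<Rightarrow> nat \<Rightarrow> ennreal" where
  "inv_power_sum_int \<mu> k = (\<integral>\<^sup>+ s \<in> {0..1}. (\<Sum>l = 1..k. 1 / (ennreal s) ^ l) \<partial>\<mu>)"

definition \<U> :: "enat \<Rightarrow> nat \<Rightarrow> (nat \<Rightarrow> real measure) \<Rightarrow> (nat \<Rightarrow> real) set" where
  "\<U> \<eta> \<kappa> \<tau> = {t \<in> J \<eta> \<rightarrow>\<^sub>E {0<..}.
     (\<Sum>\<^sub>\<infinity>i\<in>J \<eta>. ennreal ((t i)\<^sup>2)) < \<infinity> \<and>
     (if \<kappa> = 0
      then (\<Sum>\<^sub>\<infinity>i\<in>J \<eta>. ennreal ((t i)\<^sup>2))
             \<ge> 1 + (\<Sum>\<^sub>\<infinity>i\<in>J \<eta>. ennreal ((t i)\<^sup>2) * inv_power_int (\<tau> i) 1)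
      else (\<Sum>\<^sub>\<infinity>i\<in>J \<eta>. ennreal ((t i)\<^sup>2))
             = 1 + (\<Sum>\<^sub>\<infinity>i\<in>J \<eta>. ennreal ((t i)\<^sup>2) * inv_power_int (\<tau> i) 1)) \<and>
     (\<Sum>\<^sub>\<infinity>i\<in>J \<eta>. ennreal ((t i)\<^sup>2))
       > (\<Sum>\<^sub>\<infinity>i\<in>J \<eta>. ennreal ((t i)\<^sup>2) * inv_power_sum_int (\<tau> i) (\<kappa> + 1))}"

end

theory Submission imports Defs begin

text \<open>
  Only \<open>A i = \<integral> 1 / s\<close> and \<open>B i = \<integral> (1 / s + \<dots> + 1 / s ^ (\<kappa> + 1))\<close> matter, and \<open>A i \<le> B i\<close>.
  If every \<open>B i \<ge> 1\<close>, the strict inequality is impossible. Conversely, let \<open>B i\<^sub>0 < 1\<close> and let all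
  \<open>B i\<close> be finite: choose the weights \<open>t i ^ 2\<close> with \<open>i \<noteq> i\<^sub>0\<close> so small that their sums against \<open>1\<close>,
  \<open>A\<close> and \<open>B\<close> are negligible, and solve the equation, which is linear in \<open>t i\<^sub>0 ^ 2\<close>, for that
  weight. Equality is achieved for \<open>\<kappa> = 0\<close> as well.
\<close>

text \<open>The numbers \<open>(1 / 2) ^ Suc i\<close> add up to 1 over all naturals, so every
  finite partial sum over \<open>I\<close> stays below \<open>c\<close>, whether \<open>I\<close> is
  finite or infinite.\<close>

lemma infsum_ennreal_le_geometric:
  fixes f :: "nat \<Rightarrow> ennreal"
  assumes "0 \<le> c" and "\<And>i. i \<in> I \<Longrightarrow> f i \<le> ennreal (c * (1 / 2) ^ Suc i)"
  shows "(\<Sum>\<^sub>\<infinity>i\<in>I. f i) \<le> ennreal c"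
proof (rule infsum_le_finite_sums)
  show "f summable_on I"
    by (simp add: nonneg_summable_on_complete)
next
  fix F assume F: "finite F" "F \<subseteq> I"
  have sums: "(\<lambda>i. c * (1 / 2) ^ Suc i) sums c"
    using sums_mult[OF power_half_series, of c] by simp
  have "sum f F \<le> (\<Sum>i\<in>F. ennreal (c * (1 / 2) ^ Suc i))"
    using F assms(2) by (intro sum_mono) auto
  also have "\<dots> = ennreal (\<Sum>i\<in>F. c * (1 / 2) ^ Suc i)"
    using assms(1) by (intro sum_ennreal) auto
  also have "\<dots> \<le> ennreal c"
    using sum_le_suminf[OF sums_summable[OF sums] F(1)] assms(1) sums_unique[OF sums]
    by (intro ennreal_leI) auto
  finally show "sum f F \<le> ennreal c" .
qed

lemma ex_balanced_weights:
  fixes A B :: "nat \<Rightarrow> ennreal"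
  assumes le: "\<And>i. i \<in> I \<Longrightarrow> A i \<le> B i" and fin: "\<And>i. i \<in> I \<Longrightarrow> B i < \<infinity>"
    and i0: "i0 \<in> I" "B i0 < 1"
  shows "\<exists>t \<in> I \<rightarrow>\<^sub>E {0<..}.
    (\<Sum>\<^sub>\<infinity>i\<in>I. ennreal ((t i)\<^sup>2)) < \<infinity> \<and>
    (\<Sum>\<^sub>\<infinity>i\<in>I. ennreal ((t i)\<^sup>2)) = 1 + (\<Sum>\<^sub>\<infinity>i\<in>I. ennreal ((t i)\<^sup>2) * A i) \<and>
    (\<Sum>\<^sub>\<infinity>i\<in>I. ennreal ((t i)\<^sup>2) * B i) < (\<Sum>\<^sub>\<infinity>i\<in>I. ennreal ((t i)\<^sup>2))"
proof -
  define a b where "a i = enn2real (A i)" and "b i = enn2real (B i)" for i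
  have A: "A i = ennreal (a i)" and B: "B i = ennreal (b i)" if "i \<in> I" for i
    using le[OF that] fin[OF that] unfolding a_def b_def by (auto simp: le_less_trans)
  have a0: "0 \<le> a i" and b0: "0 \<le> b i" for i
    by (simp_all add: a_def b_def)
  have ab: "a i \<le> b i" if "i \<in> I" for i
    using le[OF that] b0 by (simp add: A B that)
  have b1: "b i0 < 1"
    using i0 by (simp add: B ennreal_less_one_iff)
  \<comment> \<open>A quarter of the gap between \<open>B i0\<close> and 1: three disturbances of
    size at most \<epsilon> then fit into the gap, and \<epsilon> \<le> 1/4 keeps the solved weight
    \<open>x\<close> away from 0.\<close>
  define \<epsilon> where "\<epsilon> = (1 - b i0) / 4"
  have \<epsilon>: "0 < \<epsilon>" "\<epsilon> \<le> 1 / 4"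
    using b1 b0[of i0] by (simp_all add: \<epsilon>_def)
  have "\<epsilon> * 4 = 1 - b i0"
    unfolding \<epsilon>_def by (rule nonzero_eq_divide_eq[THEN iffD1, OF _ refl]) simp
  then have b1\<epsilon>: "b i0 = 1 - 4 * \<epsilon>"
    by simp
  \<comment> \<open>Dividing by \<open>1 + b i\<close> makes \<open>y i * C i\<close> at most the
    geometric term for each of \<open>C = 1\<close>, \<open>A\<close>, \<open>B\<close>, so one
    choice of weights controls all three sums.\<close>
  define y where "y i = \<epsilon> * (1 / 2) ^ Suc i / (1 + b i)" for i
  have y0: "0 < y i" for i
    using \<epsilon> b0[of i] by (simp add: y_def)
  \<comment> \<open>Each remainder is named as a real number, so that the equation for
    \<open>x\<close> can be solved in the reals, where subtraction behaves well.\<close>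
  have small: "\<exists>r. 0 \<le> r \<and> r \<le> \<epsilon> \<and> (\<Sum>\<^sub>\<infinity>i\<in>I - {i0}. ennreal (y i) * C i) = ennreal r"
    if C: "\<And>i. i \<in> I \<Longrightarrow> C i \<le> ennreal (1 + b i)" for C
  proof -
    have "(\<Sum>\<^sub>\<infinity>i\<in>I - {i0}. ennreal (y i) * C i) \<le> ennreal \<epsilon>"
    proof (rule infsum_ennreal_le_geometric)
      fix i assume "i \<in> I - {i0}"
      then have "ennreal (y i) * C i \<le> ennreal (y i) * ennreal (1 + b i)"
        using C by (intro mult_left_mono) auto
      also have "\<dots> = ennreal (y i * (1 + b i))"
        using y0[of i] b0[of i] by (simp add: ennreal_mult)
      also have "y i * (1 + b i) = \<epsilon> * (1 / 2) ^ Suc i"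
        unfolding y_def using b0[of i] by (intro nonzero_eq_divide_eq[THEN iffD1, OF _ refl]) simp
      finally show "ennreal (y i) * C i \<le> ennreal (\<epsilon> * (1 / 2) ^ Suc i)" .
    qed (use \<epsilon> in auto)
    then show ?thesis
      using \<epsilon> by (cases "\<Sum>\<^sub>\<infinity>i\<in>I - {i0}. ennreal (y i) * C i") (auto simp: top_unique)
  qed
  have B_le: "B i \<le> ennreal (1 + b i)" if "i \<in> I" for i
    using B[OF that] by (simp add: ennreal_leI)
  have A_le: "A i \<le> ennreal (1 + b i)" if "i \<in> I" for i
    using le[OF that] B_le[OF that] by (rule order_trans)
  obtain S where S: "0 \<le> S" "S \<le> \<epsilon>" "(\<Sum>\<^sub>\<infinity>i\<in>I - {i0}. ennreal (y i) * 1) = ennreal S"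
    using small[of "\<lambda>_. 1"] b0 by auto
  obtain SA where SA: "0 \<le> SA" "SA \<le> \<epsilon>" "(\<Sum>\<^sub>\<infinity>i\<in>I - {i0}. ennreal (y i) * A i) = ennreal SA"
    using small[of A, OF A_le] by blast
  obtain SB where SB: "0 \<le> SB" "SB \<le> \<epsilon>" "(\<Sum>\<^sub>\<infinity>i\<in>I - {i0}. ennreal (y i) * B i) = ennreal SB"
    using small[of B, OF B_le] by blast
  \<comment> \<open>The solution of \<open>x + S = 1 + x * a i0 + SA\<close>; the denominator is
    positive because \<open>a i0 \<le> b i0 < 1\<close>.\<close>
  define x where "x = (1 + SA - S) / (1 - a i0)"
  have a1: "a i0 < 1"
    using ab[OF i0(1)] b1 by simp
  have x: "x = 1 + SA - S + x * a i0"
    using a1 by (simp add: x_def field_simps)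
  \<comment> \<open>The numerator is nonnegative and the denominator lies in (0, 1]. The numerator
    is also at least 1 - \<epsilon>, hence the bound 3/4.\<close>
  have "x \<ge> 1 + SA - S"
    using a1 a0[of i0] S SA \<epsilon> by (simp add: x_def le_divide_eq mult_le_cancel_left1)
  then have x_ge: "x \<ge> 3 / 4"
    using S SA \<epsilon> by simp
  \<comment> \<open>The slack \<open>x - x * b i0 = 4 * \<epsilon> * x\<close> is at least 3
    \<epsilon>, which exceeds \<open>SB \<le> \<epsilon>\<close>.\<close>
  have "4 * \<epsilon> * (3 / 4) \<le> 4 * \<epsilon> * x"
    using \<epsilon> by (intro mult_left_mono x_ge) simp
  then have "SB < 4 * \<epsilon> * x"
    using SB(2) \<epsilon> by linarith
  then have xB: "x * b i0 + SB < x + S"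
    using S by (simp add: b1\<epsilon> algebra_simps)
  define t where "t = (\<lambda>i\<in>I. sqrt (if i = i0 then x else y i))"
  have t_i0: "(t i0)\<^sup>2 = x"
    using i0 x_ge by (simp add: t_def)
  have t_other: "(t i)\<^sup>2 = y i" if "i \<in> I - {i0}" for i
    using that y0[of i] by (simp add: t_def)
  \<comment> \<open>Isolates the solved weight at \<open>i0\<close>; used with \<open>C = 1\<close>,
    \<open>A\<close> and \<open>B\<close> to turn all three series into real expressions.\<close>
  have split: "(\<Sum>\<^sub>\<infinity>i\<in>I. ennreal ((t i)\<^sup>2) * C i)
      = ennreal x * C i0 + (\<Sum>\<^sub>\<infinity>i\<in>I - {i0}. ennreal (y i) * C i)" for C
  proof -
    have "(\<Sum>\<^sub>\<infinity>i\<in>insert i0 (I - {i0}). ennreal ((t i)\<^sup>2) * C i)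
        = ennreal ((t i0)\<^sup>2) * C i0 + (\<Sum>\<^sub>\<infinity>i\<in>I - {i0}. ennreal ((t i)\<^sup>2) * C i)"
      by (rule infsum_insert) (auto simp: nonneg_summable_on_complete)
    also have "(\<Sum>\<^sub>\<infinity>i\<in>I - {i0}. ennreal ((t i)\<^sup>2) * C i) = (\<Sum>\<^sub>\<infinity>i\<in>I - {i0}. ennreal (y i) * C i)"
      by (rule infsum_cong) (simp add: t_other)
    finally show ?thesis
      using i0 by (simp add: insert_absorb t_i0)
  qed
  have T: "(\<Sum>\<^sub>\<infinity>i\<in>I. ennreal ((t i)\<^sup>2)) = ennreal (x + S)"
    using split[of "\<lambda>_. 1"] S x_ge by simp
  have TA: "(\<Sum>\<^sub>\<infinity>i\<in>I. ennreal ((t i)\<^sup>2) * A i) = ennreal (x * a i0 + SA)"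
    using split[of A] SA x_ge a0[of i0] i0 by (simp add: A ennreal_mult)
  have TB: "(\<Sum>\<^sub>\<infinity>i\<in>I. ennreal ((t i)\<^sup>2) * B i) = ennreal (x * b i0 + SB)"
    using split[of B] SB x_ge b0[of i0] i0 by (simp add: B ennreal_mult)
  have "ennreal (x + S) = ennreal (1 + (x * a i0 + SA))"
    using x by (intro arg_cong[where f = ennreal]) linarith
  also have "\<dots> = 1 + ennreal (x * a i0 + SA)"
    using SA x_ge a0[of i0] by (subst ennreal_plus) auto
  finally have "ennreal (x + S) = 1 + ennreal (x * a i0 + SA)" .
  moreover have "ennreal (x * b i0 + SB) < ennreal (x + S)"
    using xB SB x_ge b0[of i0] by (intro ennreal_lessI) (auto intro: add_pos_nonneg simp: S(1))
  moreover have "t \<in> I \<rightarrow>\<^sub>E {0<..}"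
    using x_ge y0 by (auto simp: t_def)
  ultimately show ?thesis
    by (intro bexI[of _ t]) (auto simp: T TA TB)
qed

lemma inv_power_int_le_inv_power_sum_int:
  assumes "1 \<le> l" "l \<le> k"
  shows "inv_power_int \<mu> l \<le> inv_power_sum_int \<mu> k"
  unfolding inv_power_int_def inv_power_sum_int_def
proof (intro nn_integral_mono mult_right_mono)
  fix s :: real
  show "1 / (ennreal s) ^ l \<le> (\<Sum>l = 1..k. 1 / (ennreal s) ^ l)"
    using assms member_le_sum[of l "{1..k}" "\<lambda>l. 1 / (ennreal s) ^ l"] by simp
qed simp

lemma ennreal_inverse_antimono:
  fixes a b :: ennreal
  shows "a \<le> b \<Longrightarrow> inverse b \<le> inverse a"
  by (simp add: less_eq_ennreal.rep_eq inverse_ennreal.rep_eq ereal_inverse_antimono)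

text \<open>On [0, 1] the function \<open>1 / s ^ l\<close> increases with \<open>l \<ge> 1\<close>,
  also at 0 where all values are \<infinity>, so each of the \<open>k\<close> summands is below the
  last one. Thus finiteness of the highest inverse moment gives finiteness of the whole sum.\<close>

lemma inv_power_sum_int_le:
  assumes sets: "sets \<mu> = sets (restrict_space borel {0..1})"
  shows "inv_power_sum_int \<mu> k \<le> of_nat k * inv_power_int \<mu> k"
proof -
  have "inv_power_sum_int \<mu> k \<le> (\<integral>\<^sup>+ s. of_nat k * (1 / (ennreal s) ^ k * indicator {0..1} s) \<partial>\<mu>)"
    unfolding inv_power_sum_int_def
  proof (intro nn_integral_mono)
    fix s :: real
    have "(\<Sum>l = 1..k. 1 / (ennreal s) ^ l) \<le> (\<Sum>l = 1..k. 1 / (ennreal s) ^ k)" if "s \<in> {0..1}"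
    proof (rule sum_mono)
      fix l assume "l \<in> {1..k}"
      then have "(ennreal s) ^ k \<le> (ennreal s) ^ l"
        using that by (intro power_decreasing) auto
      then show "1 / (ennreal s) ^ l \<le> 1 / (ennreal s) ^ k"
        by (simp add: divide_ennreal_def ennreal_inverse_antimono)
    qed
    then show "(\<Sum>l = 1..k. 1 / (ennreal s) ^ l) * indicator {0..1} s
        \<le> of_nat k * (1 / (ennreal s) ^ k * indicator {0..1} s)"
      by (auto simp: indicator_def)
  qed
  also have "\<dots> = of_nat k * inv_power_int \<mu> k"
    unfolding inv_power_int_def
  proof (rule nn_integral_cmult)
    \<comment> \<open>The measure lives on the subspace [0, 1], so measurability is shown on the
      real line and then restricted.\<close>
    have "(\<lambda>s :: real. 1 / (ennreal s) ^ k * indicator {0..1} s)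
        \<in> borel_measurable (restrict_space borel {0..1})"
      by (intro measurable_restrict_space1) measurable
    then show "(\<lambda>s :: real. 1 / (ennreal s) ^ k * indicator {0..1} s) \<in> borel_measurable \<mu>"
      by (simp add: measurable_cong_sets[OF sets refl])
  qed
  finally show ?thesis .
qed

theorem proposition7p3p5:
  fixes \<eta> :: enat and \<kappa> :: nat and \<tau> :: "nat \<Rightarrow> real measure"
  assumes "2 \<le> \<eta>"
    and "\<And>i. i \<in> J \<eta> \<Longrightarrow> sets (\<tau> i) = sets (restrict_space borel {0..1})"
    and "(SUP i\<in>J \<eta>. emeasure (\<tau> i) {0..1}) < \<infinity>"
  shows "\<U> \<eta> \<kappa> \<tau> \<noteq> {} \<longleftrightarrow>
    (\<forall>i\<in>J \<eta>. inv_power_int (\<tau> i) (\<kappa> + 1) < \<infinity>) \<and>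
    (\<exists>i\<^sub>0\<in>J \<eta>. inv_power_sum_int (\<tau> i\<^sub>0) (\<kappa> + 1) < 1)"
proof (intro iffI conjI)
  assume "\<U> \<eta> \<kappa> \<tau> \<noteq> {}"
  then obtain t where pos: "t \<in> J \<eta> \<rightarrow>\<^sub>E {0<..}"
    and less: "(\<Sum>\<^sub>\<infinity>i\<in>J \<eta>. ennreal ((t i)\<^sup>2) * inv_power_sum_int (\<tau> i) (\<kappa> + 1))
       < (\<Sum>\<^sub>\<infinity>i\<in>J \<eta>. ennreal ((t i)\<^sup>2))"
    unfolding \<U>_def by blast
  show "\<forall>i\<in>J \<eta>. inv_power_int (\<tau> i) (\<kappa> + 1) < \<infinity>"
  proof
    fix i assume i: "i \<in> J \<eta>"
    have "(\<Sum>\<^sub>\<infinity>i\<in>{i}. ennreal ((t i)\<^sup>2) * inv_power_sum_int (\<tau> i) (\<kappa> + 1))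
        \<le> (\<Sum>\<^sub>\<infinity>i\<in>J \<eta>. ennreal ((t i)\<^sup>2) * inv_power_sum_int (\<tau> i) (\<kappa> + 1))"
      using i by (intro infsum_mono_neutral nonneg_summable_on_complete) auto
    \<comment> \<open>Anything strictly below another extended value is finite; the positive factor
      \<open>(t i)\<^sup>2\<close> can then be dropped from the single term.\<close>
    also have "\<dots> < \<infinity>"
      using less by (simp add: less_top order.strict_implies_not_eq less_le_trans)
    finally have "ennreal ((t i)\<^sup>2) * inv_power_sum_int (\<tau> i) (\<kappa> + 1) < \<infinity>"
      by simp
    moreover have "0 < t i"
      using pos i by auto
    ultimately have "inv_power_sum_int (\<tau> i) (\<kappa> + 1) < \<infinity>"
      by (auto simp: ennreal_mult_less_top)
    then show "inv_power_int (\<tau> i) (\<kappa> + 1) < \<infinity>"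
      using inv_power_int_le_inv_power_sum_int[of "\<kappa> + 1" "\<kappa> + 1" "\<tau> i"] by (simp add: le_less_trans)
  qed
  show "\<exists>i\<^sub>0\<in>J \<eta>. inv_power_sum_int (\<tau> i\<^sub>0) (\<kappa> + 1) < 1"
  proof (rule ccontr)
    assume "\<not> ?thesis"
    then have ge: "1 \<le> inv_power_sum_int (\<tau> i) (\<kappa> + 1)" if "i \<in> J \<eta>" for i
      using that by (auto simp: not_less)
    have "(\<Sum>\<^sub>\<infinity>i\<in>J \<eta>. ennreal ((t i)\<^sup>2))
        \<le> (\<Sum>\<^sub>\<infinity>i\<in>J \<eta>. ennreal ((t i)\<^sup>2) * inv_power_sum_int (\<tau> i) (\<kappa> + 1))"
    proof (intro infsum_mono nonneg_summable_on_complete)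
      fix i assume "i \<in> J \<eta>"
      then show "ennreal ((t i)\<^sup>2) \<le> ennreal ((t i)\<^sup>2) * inv_power_sum_int (\<tau> i) (\<kappa> + 1)"
        using mult_left_mono[OF ge, of i "ennreal ((t i)\<^sup>2)"] by simp
    qed auto
    with less show False
      by simp
  qed
next
  assume R: "(\<forall>i\<in>J \<eta>. inv_power_int (\<tau> i) (\<kappa> + 1) < \<infinity>) \<and>
    (\<exists>i\<^sub>0\<in>J \<eta>. inv_power_sum_int (\<tau> i\<^sub>0) (\<kappa> + 1) < 1)"
  then obtain i0 where i0: "i0 \<in> J \<eta>" "inv_power_sum_int (\<tau> i0) (\<kappa> + 1) < 1"
    by blast
  have fin: "inv_power_sum_int (\<tau> i) (\<kappa> + 1) < \<infinity>" if i: "i \<in> J \<eta>" for i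
  proof -
    have "of_nat (\<kappa> + 1) * inv_power_int (\<tau> i) (\<kappa> + 1) < \<infinity>"
      using R i by (simp add: ennreal_mult_less_top of_nat_less_top del: of_nat_Suc)
    with inv_power_sum_int_le[OF assms(2)[OF i]] show ?thesis
      by (rule le_less_trans)
  qed
  have "inv_power_int (\<tau> i) 1 \<le> inv_power_sum_int (\<tau> i) (\<kappa> + 1)" for i
    by (rule inv_power_int_le_inv_power_sum_int) auto
  from ex_balanced_weights[of "J \<eta>" "\<lambda>i. inv_power_int (\<tau> i) 1", OF this fin i0]
  obtain t where "t \<in> J \<eta> \<rightarrow>\<^sub>E {0<..}"
    "(\<Sum>\<^sub>\<infinity>i\<in>J \<eta>. ennreal ((t i)\<^sup>2)) < \<infinity>"
    "(\<Sum>\<^sub>\<infinity>i\<in>J \<eta>. ennreal ((t i)\<^sup>2)) = 1 + (\<Sum>\<^sub>\<infinity>i\<in>J \<eta>. ennreal ((t i)\<^sup>2) * inv_power_int (\<tau> i) 1)"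
    "(\<Sum>\<^sub>\<infinity>i\<in>J \<eta>. ennreal ((t i)\<^sup>2) * inv_power_sum_int (\<tau> i) (\<kappa> + 1))
       < (\<Sum>\<^sub>\<infinity>i\<in>J \<eta>. ennreal ((t i)\<^sup>2))"
    by blast
  \<comment> \<open>Equality serves both branches of the \<open>if\<close>: for \<kappa> = 0 the
    required inequality follows by reflexivity.\<close>
  then have "t \<in> \<U> \<eta> \<kappa> \<tau>"
    unfolding \<U>_def mem_Collect_eq by (metis order_refl)
  then show "\<U> \<eta> \<kappa> \<tau> \<noteq> {}"
    by blast
qed

end
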